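(* Let $\{(x_k,x_k^* )\}_{k\ge0}$ be generated by the stochastic block Bregman projection (SBBP) method with the decreasing mirror stochastic Polyak stepsize (DecmSPS) $t_k$, under the sampling rule described in the context, and let $\{\lambda_k\}$ be nonincreasing with $0<\lambda_k\le1$. Fix $\hat x\in\bar X$ and $K\ge1$, and let $D<\infty$ be the maximum of $D_\psi^{x_k^*}(x_k,\hat x)$ over $0\le k\le K-1$ and over all realizations of the random samples. Then $$\mathbb{E}\left[F(\bar x_K)-\bar F\right]\le\frac1K\left(\frac{2D}{\lambda_{K-1}\tilde L}+\sigma_\tau^2\sum_{k=0}^{K-1}\lambda_k\right),$$ where $\bar x_K=\frac1K\sum_{k=0}^{K-1}x_k$ and $\tilde L=\min\left\{\frac{\mu}{2L_{\max}},\frac{\gamma_b}{\lambda_0}\right\}$.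
   Context: Notation: $[m]=\{1,\dots,m\}$; $\|\cdot\|$ is the Euclidean norm. Problem data: $\psi:\mathbb{R}^n\to\mathbb{R}$ is $\mu$-strongly convex ($\mu>0$); each $f_i:\mathbb{R}^n\to\mathbb{R}$, $i\in[m]$, is convex and differentiable with $L_i$-Lipschitz gradient, $L_i>0$; $L_{\max}=\max_{i\in[m]}L_i$; $F(x)=\frac1m\sum_{i=1}^mf_i(x)$; $\bar F=\min_{x\in\mathbb{R}^n}F(x)$ and $\bar X=\arg\min_{x\in\mathbb{R}^n}F(x)$ is nonempty. $\psi^*$ is the Fenchel conjugate of $\psi$ (differentiable with $1/\mu$-Lipschitz gradient). For $x^*\in\partial\psi(x)$, $D_\psi^{x^*}(x,y)=\psi(y)-\psi(x)-\langle x^*,y-x\rangle$. Sampling rule: fix $\tau\in\{1,\dots,m\}$. At each iteration $k\ge0$ a random subset $J_k\subset[m]$ with $|J_k|=\tau$ is drawn from a fixed distribution with $\mathbf P(i\in J_k)=\tau/m$ for all $i\in[m]$, independently of $J_0,\dots,J_{k-1}$; weights are $w_{i,k}=w_i=1/\tau$, $i\in J_k$. SBBP method: $x_0\in\mathbb{R}^n$, $x_0^*\in\partial\psi(x_0)$ and $$x_{k+1}^*=x_k^*-t_k\sum_{i\in J_k}w_{i,k}\nabla f_i(x_k),\qquad x_{k+1}=\nabla\psi^*(x_{k+1}^* ).$$ DecmSPS: for each $J$ let $l_J^*\in\mathbb{R}$ be any lower bound with $l_J^*\le\inf_{x\in\mathbb{R}^n}\sum_{i\in J}w_if_i(x)$.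 With a nonincreasing positive sequence $\{\lambda_k\}_{k\ge0}$, $\lambda_{-1}=\lambda_0$ and $t_{-1}=\gamma_b>0$, $$t_k=\lambda_k\min\left\{\mu\cdot\frac{\sum_{i\in J_k}w_{i,k}f_i(x_k)-l_{J_k}^*}{\|\sum_{i\in J_k}w_{i,k}\nabla f_i(x_k)\|^2},\ \frac{t_{k-1}}{\lambda_{k-1}}\right\},\quad k\ge0,$$ where the first entry of the minimum is read as $+\infty$ if its denominator is zero. Noise constant: for $\hat x\in\bar X$, $\sigma_\tau^2=\mathbb{E}\left[\sum_{i\in J}w_if_i(\hat x)-l_J^*\right]$, where $J$ has the sampling distribution (the value does not depend on the choice of $\hat x\in\bar X$). *)

theory Defs
  imports "HOL-Probability.Probability"
begin

definition strongly_convex :: "real \<Rightarrow> ('a::real_inner \<Rightarrow> real) \<Rightarrow> bool" where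
  "strongly_convex \<mu> \<psi> \<longleftrightarrow>
     (\<forall>x y. \<forall>\<theta>\<in>{0..1}. \<psi> (\<theta> *\<^sub>R x + (1 - \<theta>) *\<^sub>R y)
        \<le> \<theta> * \<psi> x + (1 - \<theta>) * \<psi> y - \<mu> / 2 * \<theta> * (1 - \<theta>) * (norm (x - y))\<^sup>2)"

definition subdifferential :: "('a::real_inner \<Rightarrow> real) \<Rightarrow> 'a \<Rightarrow> 'a set" where
  "subdifferential \<psi> x = {g. \<forall>y. \<psi> x + g \<bullet> (y - x) \<le> \<psi> y}"

(* The supremum is taken in the reals; it is the true one whenever the function is
   superlinear, in particular when it is real-valued and strongly convex. *)
definition fenchel_conjugate :: "('a::real_inner \<Rightarrow> real) \<Rightarrow> 'a \<Rightarrow> real" where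
  "fenchel_conjugate \<psi> y = (SUP x. y \<bullet> x - \<psi> x)"

(* Unspecified where the function has no gradient. *)
definition gradient :: "('a::real_inner \<Rightarrow> real) \<Rightarrow> 'a \<Rightarrow> 'a" where
  "gradient f x = (THE g. GDERIV f x :> g)"

lemma gradient_eqI:
  assumes "GDERIV f x :> g"
  shows "gradient f x = g"
  unfolding gradient_def
proof (rule the_equality[where P = "\<lambda>g. GDERIV f x :> g", OF assms])
  fix h assume "GDERIV f x :> h"
  with assms have "(\<lambda>v. inner v h) = (\<lambda>v. inner v g)"
    unfolding gderiv_def by (rule has_derivative_unique[rotated])
  then have "inner (h - g) h = inner (h - g) g" by (rule fun_cong)
  then have "inner (h - g) (h - g) = 0" by (simp only: inner_diff_right)
  then show "h = g" by simp
qed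

definition bregman :: "('a::real_inner \<Rightarrow> real) \<Rightarrow> 'a \<Rightarrow> 'a \<Rightarrow> 'a \<Rightarrow> real" where
  "bregman \<psi> xs x y = \<psi> y - \<psi> x - xs \<bullet> (y - x)"

definition objective :: "nat \<Rightarrow> (nat \<Rightarrow> 'a \<Rightarrow> real) \<Rightarrow> 'a \<Rightarrow> real" where
  "objective m f x = 1 / real m * (\<Sum>i=1..m. f i x)"

definition argmin_set :: "('a \<Rightarrow> real) \<Rightarrow> 'a set" where
  "argmin_set F = {x. is_arg_min F (\<lambda>_. True) x}"

definition blocks :: "nat \<Rightarrow> nat \<Rightarrow> nat set set" where
  "blocks m \<tau> = {A. A \<subseteq> {1..m} \<and> card A = \<tau>}"

definition block_fun :: "nat \<Rightarrow> (nat \<Rightarrow> 'a \<Rightarrow> real) \<Rightarrow> nat set \<Rightarrow> 'a \<Rightarrow> real" where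
  "block_fun \<tau> f A x = (\<Sum>i\<in>A. 1 / real \<tau> * f i x)"

definition block_grad ::
  "nat \<Rightarrow> (nat \<Rightarrow> 'a::real_inner \<Rightarrow> real) \<Rightarrow> nat set \<Rightarrow> 'a \<Rightarrow> 'a" where
  "block_grad \<tau> f A x = (\<Sum>i\<in>A. (1 / real \<tau>) *\<^sub>R gradient (f i) x)"

(* r stands for the ratio of the previous step size to the previous relaxation parameter.
   The case distinction reads the Polyak quotient as infinity when its denominator is zero. *)
definition decmsps ::
  "nat \<Rightarrow> (nat \<Rightarrow> 'a::real_inner \<Rightarrow> real) \<Rightarrow> real \<Rightarrow> (nat set \<Rightarrow> real)
    \<Rightarrow> real \<Rightarrow> real \<Rightarrow> nat set \<Rightarrow> 'a \<Rightarrow> real" where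
  "decmsps \<tau> f \<mu> lstar lam r A x =
     lam * (if norm (block_grad \<tau> f A x) = 0 then r
            else min (\<mu> * ((block_fun \<tau> f A x - lstar A) / (norm (block_grad \<tau> f A x))\<^sup>2)) r)"

(* State after k iterations along the sample path s: the primal iterate x_k, the dual
   iterate x*_k and the step size t_(k-1), with t_(-1) = gb. Natural subtraction makes
   lam (k - 1) equal lam 0 for k = 0, which is the convention lam_(-1) = lam_0. *)
primrec sbbp ::
  "('a::real_inner \<Rightarrow> real) \<Rightarrow> nat \<Rightarrow> (nat \<Rightarrow> 'a \<Rightarrow> real) \<Rightarrow> real \<Rightarrow> (nat set \<Rightarrow> real)
    \<Rightarrow> (nat \<Rightarrow> real) \<Rightarrow> real \<Rightarrow> 'a \<Rightarrow> 'a \<Rightarrow> (nat \<Rightarrow> nat set) \<Rightarrow> nat \<Rightarrow> 'a \<times> 'a \<times> real" where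
  "sbbp \<psi> \<tau> f \<mu> lstar lam gb x0 xs0 s 0 = (x0, xs0, gb)"
| "sbbp \<psi> \<tau> f \<mu> lstar lam gb x0 xs0 s (Suc k) =
     (case sbbp \<psi> \<tau> f \<mu> lstar lam gb x0 xs0 s k of (x, xs, tprev) \<Rightarrow>
        let t = decmsps \<tau> f \<mu> lstar (lam k) (tprev / lam (k - 1)) (s k) x;
            xs' = xs - t *\<^sub>R block_grad \<tau> f (s k) x
        in (gradient (fenchel_conjugate \<psi>) xs', xs', t))"

definition sbbp_primal ::
  "('a::real_inner \<Rightarrow> real) \<Rightarrow> nat \<Rightarrow> (nat \<Rightarrow> 'a \<Rightarrow> real) \<Rightarrow> real \<Rightarrow> (nat set \<Rightarrow> real)
    \<Rightarrow> (nat \<Rightarrow> real) \<Rightarrow> real \<Rightarrow> 'a \<Rightarrow> 'a \<Rightarrow> (nat \<Rightarrow> nat set) \<Rightarrow> nat \<Rightarrow> 'a" where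
  "sbbp_primal \<psi> \<tau> f \<mu> lstar lam gb x0 xs0 s k =
     fst (sbbp \<psi> \<tau> f \<mu> lstar lam gb x0 xs0 s k)"

definition sbbp_dual ::
  "('a::real_inner \<Rightarrow> real) \<Rightarrow> nat \<Rightarrow> (nat \<Rightarrow> 'a \<Rightarrow> real) \<Rightarrow> real \<Rightarrow> (nat set \<Rightarrow> real)
    \<Rightarrow> (nat \<Rightarrow> real) \<Rightarrow> real \<Rightarrow> 'a \<Rightarrow> 'a \<Rightarrow> (nat \<Rightarrow> nat set) \<Rightarrow> nat \<Rightarrow> 'a" where
  "sbbp_dual \<psi> \<tau> f \<mu> lstar lam gb x0 xs0 s k =
     fst (snd (sbbp \<psi> \<tau> f \<mu> lstar lam gb x0 xs0 s k))"

(* The random sets J 0, J 1, ... take values in the \<tau>-element subsets of {1..m}, are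
   mutually independent and all have law p. *)
definition block_sampling ::
  "'w measure \<Rightarrow> (nat \<Rightarrow> 'w \<Rightarrow> nat set) \<Rightarrow> nat set pmf \<Rightarrow> nat \<Rightarrow> nat \<Rightarrow> bool" where
  "block_sampling M J p m \<tau> \<longleftrightarrow>
     prob_space M \<and>
     set_pmf p \<subseteq> blocks m \<tau> \<and>
     (\<forall>i\<in>{1..m}. measure_pmf.prob p {A. i \<in> A} = real \<tau> / real m) \<and>
     prob_space.indep_vars M (\<lambda>_. count_space (blocks m \<tau>)) J UNIV \<and>
     (\<forall>k. distr M (count_space UNIV) (J k) = measure_pmf p)"

definition noise_const ::
  "nat \<Rightarrow> (nat \<Rightarrow> 'a \<Rightarrow> real) \<Rightarrow> (nat set \<Rightarrow> real) \<Rightarrow> nat set pmf \<Rightarrow> 'a \<Rightarrow> real" where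
  "noise_const \<tau> f lstar p xh = measure_pmf.expectation p (\<lambda>A. block_fun \<tau> f A xh - lstar A)"

end

theory Submission
  imports Defs
begin

text \<open>
  Write d_k for the Bregman distance from the k-th iterate to the minimiser. A mirror step lowers
  d_k by t_k times the gap of the sampled block, up to an error t_k^2 |g|^2 / (2 mu), which the
  Polyak quotient in the step size bounds by t_k lam_k / 2 times (block value - lower bound).
  Dividing by the nonincreasing t_k and telescoping costs at most D / t_(K-1), and smoothness gives
  t_k \<ge> lam_k Ltilde. After splitting (block value - lower bound) into gap plus noise, the gap
  carries the factor 1 - lam_k / 2. A sampled gap may be negative, so this factor is bounded below
  by 1 / 2 only after taking expectations, where independence turns the gap into E F(x_k) - min F.
\<close>

section \<open>Strongly convex functions and their conjugates\<close>

text \<open>Young's inequality: the squared norm of \<open>v - \<mu> *\<^sub>R w\<close> is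
  nonnegative; expand it and divide by \<open>2 * \<mu>\<close>.\<close>

lemma inner_minus_sq_le:
  fixes v w :: "'a::real_inner"
  assumes "\<mu> > 0"
  shows "v \<bullet> w - \<mu> / 2 * (norm w)\<^sup>2 \<le> (norm v)\<^sup>2 / (2 * \<mu>)"
proof -
  have "0 \<le> (norm (v - \<mu> *\<^sub>R w))\<^sup>2" by simp
  also have "\<dots> = (norm v)\<^sup>2 - 2 * \<mu> * (v \<bullet> w) + \<mu>\<^sup>2 * (norm w)\<^sup>2"
    unfolding power2_norm_eq_inner
    by (simp add: inner_diff_left inner_diff_right inner_commute power2_eq_square)
  finally show ?thesis
    using assms by (simp add: field_simps power2_eq_square)
qed

lemma strongly_convex_imp_convex_on:
  assumes "strongly_convex \<mu> \<psi>" "\<mu> \<ge> 0"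
  shows "convex_on UNIV \<psi>"
proof (rule convex_onI)
  fix t :: real and x y
  assume t: "0 < t" "t < 1"
  from t have "\<psi> ((1 - t) *\<^sub>R x + (1 - (1 - t)) *\<^sub>R y)
      \<le> (1 - t) * \<psi> x + (1 - (1 - t)) * \<psi> y
        - \<mu> / 2 * (1 - t) * (1 - (1 - t)) * (norm (x - y))\<^sup>2"
    using assms(1) unfolding strongly_convex_def
    by (metis atLeastAtMost_iff diff_ge_0_iff_ge diff_le_eq le_add_same_cancel1 less_eq_real_def)
  moreover have "0 \<le> \<mu> / 2 * (1 - t) * (1 - (1 - t)) * (norm (x - y))\<^sup>2"
    using t assms(2) by simp
  ultimately show "\<psi> ((1 - t) *\<^sub>R x + t *\<^sub>R y) \<le> (1 - t) * \<psi> x + t * \<psi> y"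
    by simp
qed simp

text \<open>Compare the subgradient inequality with strong convexity at the point a fraction
  \<theta> of the way from \<open>x\<close> to \<open>z\<close>, divide by \<theta>, and let
  \<theta> tend to 0.\<close>

lemma strongly_convex_subgradient_lower_bound:
  assumes sc: "strongly_convex \<mu> \<psi>" and g: "g \<in> subdifferential \<psi> x"
  shows "\<psi> x + g \<bullet> (z - x) + \<mu> / 2 * (norm (z - x))\<^sup>2 \<le> \<psi> z"
proof -
  let ?d = "\<psi> z - \<psi> x" and ?e = "\<mu> / 2 * (norm (z - x))\<^sup>2"
  have *: "g \<bullet> (z - x) + ?e \<le> ?d + \<theta> * ?e" if \<theta>: "0 < \<theta>" "\<theta> < 1" for \<theta>
  proof -
    have "\<psi> x + \<theta> * (g \<bullet> (z - x)) \<le> \<psi> (\<theta> *\<^sub>R z + (1 - \<theta>) *\<^sub>R x)"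
      using g[unfolded subdifferential_def, simplified, rule_format, of "\<theta> *\<^sub>R z + (1 - \<theta>) *\<^sub>R x"]
      by (simp add: algebra_simps)
    also have "\<dots> \<le> \<theta> * \<psi> z + (1 - \<theta>) * \<psi> x - \<mu> / 2 * \<theta> * (1 - \<theta>) * (norm (z - x))\<^sup>2"
      using sc \<theta> by (simp add: strongly_convex_def)
    also have "\<dots> = \<psi> x + \<theta> * (?d + \<theta> * ?e - ?e)"
      by (simp add: field_simps)
    finally have "\<theta> * (g \<bullet> (z - x)) \<le> \<theta> * (?d + \<theta> * ?e - ?e)"
      by simp
    then show ?thesis using \<theta> by (simp add: mult_le_cancel_left_pos)
  qed
  have "((\<lambda>\<theta>. ?d + \<theta> * ?e) \<longlongrightarrow> ?d + 0 * ?e) (at_right 0)"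
    by (intro tendsto_intros)
  moreover have "eventually (\<lambda>\<theta>. g \<bullet> (z - x) + ?e \<le> ?d + \<theta> * ?e) (at_right 0)"
    by (rule eventually_at_rightI[of 0 1], rule *) simp_all
  ultimately have "g \<bullet> (z - x) + ?e \<le> ?d + 0 * ?e"
    by (rule tendsto_lowerbound) simp
  then show ?thesis by simp
qed

text \<open>Every dual vector \<open>y\<close> has a primal partner: a minimiser of
  \<open>\<psi> z - y \<bullet> z\<close>. It exists because the quadratic growth around
  \<open>x0\<close> supplied by \<open>g0\<close> confines the search to a compact ball.\<close>

lemma strongly_convex_ex_subgradient_point:
  fixes \<psi> :: "'a::euclidean_space \<Rightarrow> real"
  assumes sc: "strongly_convex \<mu> \<psi>" and \<mu>: "\<mu> > 0"
    and g0: "g0 \<in> subdifferential \<psi> x0"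
  shows "\<exists>x. y \<in> subdifferential \<psi> x"
proof -
  define h where "h z = \<psi> z - y \<bullet> z" for z
  \<comment> \<open>Beyond distance \<open>R\<close> from \<open>x0\<close>, the quadratic growth
    outweighs a linear term of slope \<open>norm (g0 - y)\<close>.\<close>
  define R where "R = 2 * norm (g0 - y) / \<mu>"
  have "continuous_on UNIV \<psi>"
    using convex_on_continuous[OF open_UNIV strongly_convex_imp_convex_on[OF sc]] \<mu> by simp
  then have "continuous_on (cball x0 R) h"
    unfolding h_def by (intro continuous_intros) (auto intro: continuous_on_subset)
  moreover have "R \<ge> 0" using \<mu> by (simp add: R_def)
  ultimately have "\<exists>x\<in>cball x0 R. \<forall>z\<in>cball x0 R. h x \<le> h z"
    by (intro continuous_attains_inf) auto
  then obtain x where x: "\<And>z. z \<in> cball x0 R \<Longrightarrow> h x \<le> h z"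
    by blast
  have "h x \<le> h z" for z
  proof (cases "z \<in> cball x0 R")
    case False
    then have "R < norm (z - x0)" by (simp add: dist_norm norm_minus_commute)
    then have big: "norm (g0 - y) \<le> \<mu> / 2 * norm (z - x0)"
      using \<mu> by (simp add: R_def field_simps)
    have "- ((g0 - y) \<bullet> (z - x0)) \<le> norm (g0 - y) * norm (z - x0)"
      using norm_cauchy_schwarz[of "- (g0 - y)" "z - x0"] by (metis inner_minus_left norm_minus_cancel)
    also have "\<dots> \<le> \<mu> / 2 * norm (z - x0) * norm (z - x0)"
      by (rule mult_right_mono[OF big]) simp
    finally have "0 \<le> (g0 - y) \<bullet> (z - x0) + \<mu> / 2 * (norm (z - x0))\<^sup>2"
      by (simp add: power2_eq_square)
    moreover have "h x0 + (g0 - y) \<bullet> (z - x0) + \<mu> / 2 * (norm (z - x0))\<^sup>2 \<le> h z"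
      using strongly_convex_subgradient_lower_bound[OF sc g0, of z]
      by (simp add: h_def algebra_simps)
    moreover have "h x \<le> h x0" using x \<open>R \<ge> 0\<close> by simp
    ultimately show ?thesis by linarith
  qed (rule x)
  then have "y \<in> subdifferential \<psi> x"
    by (auto simp: subdifferential_def h_def inner_diff_right algebra_simps)
  then show ?thesis ..
qed

text \<open>The conjugate at \<open>v\<close> lies between \<open>v \<bullet> x - \<psi> x\<close>
  and the same value plus \<open>(norm (v - y))^2 / (2 * \<mu>)\<close>. Both bounds meet at
  \<open>y\<close>, so the linearisation with slope \<open>x\<close> has a quadratic error
  there.\<close>

lemma gradient_fenchel_conjugate_eqI:
  fixes \<psi> :: "'a::euclidean_space \<Rightarrow> real"
  assumes sc: "strongly_convex \<mu> \<psi>" and \<mu>: "\<mu> > 0" and g: "y \<in> subdifferential \<psi> x"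
  shows "gradient (fenchel_conjugate \<psi>) y = x"
proof (rule gradient_eqI)
  have upper: "v \<bullet> z - \<psi> z \<le> y \<bullet> x - \<psi> x + (v - y) \<bullet> x + (norm (v - y))\<^sup>2 / (2 * \<mu>)" for v z
    using strongly_convex_subgradient_lower_bound[OF sc g, of z]
      inner_minus_sq_le[OF \<mu>, of "v - y" "z - x"]
    by (simp add: inner_diff_left inner_diff_right)
  \<comment> \<open>Boundedness is what makes the real-valued supremum dominate its terms.\<close>
  have bdd: "bdd_above (range (\<lambda>z. v \<bullet> z - \<psi> z))" for v
    using upper by (intro bdd_aboveI) auto
  have le: "fenchel_conjugate \<psi> v \<le> y \<bullet> x - \<psi> x + (v - y) \<bullet> x + (norm (v - y))\<^sup>2 / (2 * \<mu>)" for v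
    unfolding fenchel_conjugate_def by (rule cSUP_least) (use upper in auto)
  have ge: "v \<bullet> x - \<psi> x \<le> fenchel_conjugate \<psi> v" for v
    unfolding fenchel_conjugate_def by (rule cSUP_upper) (use bdd in auto)
  have eq: "fenchel_conjugate \<psi> y = y \<bullet> x - \<psi> x"
    using le[of y] ge[of y] by simp
  show "GDERIV (fenchel_conjugate \<psi>) y :> x"
    unfolding gderiv_def has_derivative_iff_norm
  proof (intro conjI)
    show "((\<lambda>v. norm (fenchel_conjugate \<psi> v - fenchel_conjugate \<psi> y - (v - y) \<bullet> x) / norm (v - y))
        \<longlongrightarrow> 0) (at y)"
    proof (rule tendsto_sandwich[OF _ _ tendsto_const])
      show "((\<lambda>v. norm (v - y) / (2 * \<mu>)) \<longlongrightarrow> 0) (at y)"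
        using \<mu> by (auto intro!: tendsto_eq_intros)
      have "norm (fenchel_conjugate \<psi> v - fenchel_conjugate \<psi> y - (v - y) \<bullet> x) / norm (v - y)
          \<le> norm (v - y) / (2 * \<mu>)" for v
      proof -
        have "norm (fenchel_conjugate \<psi> v - fenchel_conjugate \<psi> y - (v - y) \<bullet> x)
            \<le> (norm (v - y))\<^sup>2 / (2 * \<mu>)"
          using le[of v] ge[of v] eq by (simp add: inner_diff_left)
        then show ?thesis
          by (cases "v = y") (simp_all add: divide_le_eq power2_eq_square)
      qed
      then show "\<forall>\<^sub>F v in at y. norm (fenchel_conjugate \<psi> v - fenchel_conjugate \<psi> y - (v - y) \<bullet> x)
          / norm (v - y) \<le> norm (v - y) / (2 * \<mu>)" by simp
    qed simp
  qed (rule bounded_linear_inner_left)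
qed

text \<open>The exact change is \<open>v \<bullet> (z - x) + v \<bullet> (x - x')\<close> minus
  \<open>bregman \<psi> y x x'\<close>. Strong convexity makes the subtracted term at least
  quadratic in \<open>x' - x\<close>, and Young's inequality then absorbs
  \<open>v \<bullet> (x - x')\<close>.\<close>

lemma bregman_mirror_step:
  assumes sc: "strongly_convex \<mu> \<psi>" and \<mu>: "\<mu> > 0"
    and y: "y \<in> subdifferential \<psi> x"
  shows "bregman \<psi> (y - v) x' z
    \<le> bregman \<psi> y x z + v \<bullet> (z - x) + (norm v)\<^sup>2 / (2 * \<mu>)"
proof -
  have "bregman \<psi> (y - v) x' z - bregman \<psi> y x z
      = \<psi> x - \<psi> x' + y \<bullet> (x' - x) + v \<bullet> (z - x) + v \<bullet> (x - x')"
    by (simp add: bregman_def inner_diff_left inner_diff_right)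
  moreover have "v \<bullet> (x - x') - \<mu> / 2 * (norm (x' - x))\<^sup>2 \<le> (norm v)\<^sup>2 / (2 * \<mu>)"
    using inner_minus_sq_le[OF \<mu>, of v "x - x'"] by (simp add: norm_minus_commute)
  ultimately show ?thesis
    using strongly_convex_subgradient_lower_bound[OF sc y, of x'] by linarith
qed

lemma bregman_nonneg:
  "y \<in> subdifferential \<psi> x \<Longrightarrow> 0 \<le> bregman \<psi> y x z"
  unfolding bregman_def subdifferential_def mem_Collect_eq by (drule spec[of _ z]) linarith

section \<open>Smooth convex functions\<close>

text \<open>The derivative is a linear functional, represented by its adjoint at 1; so the
  description in \<open>gradient\<close> denotes.\<close>

lemma GDERIV_gradient:
  fixes f :: "'a::euclidean_space \<Rightarrow> real"
  assumes "f differentiable (at x)"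
  shows "GDERIV f x :> gradient f x"
proof -
  from assms obtain f' where f': "(f has_derivative f') (at x)"
    unfolding differentiable_def by blast
  then have "f' = (\<lambda>h. h \<bullet> adjoint f' 1)"
    using adjoint_works[OF has_derivative_linear[OF f'], of _ 1] by (intro ext) simp
  with f' have "GDERIV f x :> adjoint f' 1"
    unfolding gderiv_def by metis
  then show ?thesis using gradient_eqI by metis
qed

lemma GDERIV_line:
  assumes "GDERIV f (x + t *\<^sub>R v) :> g"
  shows "((\<lambda>s. f (x + s *\<^sub>R v)) has_real_derivative v \<bullet> g) (at t)"
proof -
  have "((\<lambda>s. x + s *\<^sub>R v) has_derivative (\<lambda>s. s *\<^sub>R v)) (at t)"
    by (auto intro!: derivative_eq_intros)
  from has_derivative_compose[OF this assms[unfolded gderiv_def]]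
  show ?thesis by (simp add: has_field_derivative_def mult_commute_abs)
qed

text \<open>On the line through \<open>x\<close> and \<open>z\<close> this is the one-dimensional
  tangent inequality at parameter 0, read at parameter 1.\<close>

lemma convex_on_gradient_le:
  assumes cv: "convex_on UNIV f" and g: "GDERIV f x :> g"
  shows "f x + g \<bullet> (z - x) \<le> f z"
proof -
  define h where "h s = f (x + s *\<^sub>R (z - x))" for s
  have "convex_on UNIV h"
  proof (rule convex_onI)
    fix t a b :: real assume "0 < t" "t < 1"
    moreover have "x + ((1 - t) *\<^sub>R a + t *\<^sub>R b) *\<^sub>R (z - x)
        = (1 - t) *\<^sub>R (x + a *\<^sub>R (z - x)) + t *\<^sub>R (x + b *\<^sub>R (z - x))"
      by (simp add: algebra_simps)
    ultimately show "h ((1 - t) *\<^sub>R a + t *\<^sub>R b) \<le> (1 - t) * h a + t * h b"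
      using convex_onD[OF cv, of t] by (simp add: h_def)
  qed simp
  moreover have "(h has_real_derivative (z - x) \<bullet> g) (at 0)"
    unfolding h_def using g by (intro GDERIV_line) simp
  ultimately have "(z - x) \<bullet> g * (1 - 0) \<le> h 1 - h 0"
    by (intro convex_on_imp_above_tangent[of UNIV]) auto
  then show ?thesis by (simp add: h_def inner_commute)
qed

text \<open>Along the segment, subtract the linear and quadratic terms of the model. Cauchy-Schwarz
  and the Lipschitz bound give the difference \<open>h\<close> a nonpositive derivative on the unit
  interval, so \<open>h 1 \<le> h 0\<close>.\<close>

lemma descent_lemma:
  fixes f :: "'a::real_inner \<Rightarrow> real"
  assumes g: "\<And>y. GDERIV f y :> g y" and lip: "C-lipschitz_on UNIV g"
  shows "f (x + v) \<le> f x + g x \<bullet> v + C / 2 * (norm v)\<^sup>2"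
proof -
  define h where "h s = f (x + s *\<^sub>R v) - s * (v \<bullet> g x) - C / 2 * s\<^sup>2 * (norm v)\<^sup>2" for s
  have "h 1 \<le> h 0"
  proof (rule DERIV_nonpos_imp_nonincreasing[of 0 1 h])
    fix s :: real assume s: "0 \<le> s" "s \<le> 1"
    have "(h has_real_derivative v \<bullet> g (x + s *\<^sub>R v) - v \<bullet> g x - C * s * (norm v)\<^sup>2) (at s)"
      unfolding h_def by (auto intro!: derivative_eq_intros GDERIV_line g)
    moreover have "v \<bullet> g (x + s *\<^sub>R v) - v \<bullet> g x \<le> C * s * (norm v)\<^sup>2"
    proof -
      have "v \<bullet> (g (x + s *\<^sub>R v) - g x) \<le> norm v * norm (g (x + s *\<^sub>R v) - g x)"
        by (rule norm_cauchy_schwarz)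
      also have "\<dots> \<le> norm v * (C * norm (s *\<^sub>R v))"
        using lipschitz_onD[OF lip, of "x + s *\<^sub>R v" x]
        by (intro mult_left_mono) (simp_all add: dist_norm)
      finally show ?thesis using s by (simp add: inner_diff_right power2_eq_square ac_simps)
    qed
    ultimately show "\<exists>y. (h has_real_derivative y) (at s) \<and> y \<le> 0" by (intro exI conjI) auto
  qed simp
  then show ?thesis by (simp add: h_def inner_commute)
qed

text \<open>A gradient step of length \<open>1 / C\<close> minimises the quadratic upper bound,
  lowering it by \<open>(norm (g x))^2 / (2 * C)\<close>; the function cannot fall below
  \<open>l\<close>. This keeps the Polyak quotient away from zero.\<close>

lemma norm_gradient_sq_le:
  fixes f :: "'a::real_inner \<Rightarrow> real"
  assumes g: "\<And>y. GDERIV f y :> g y" and lip: "C-lipschitz_on UNIV g" and C: "C > 0"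
    and lower: "\<And>y. l \<le> f y"
  shows "(norm (g x))\<^sup>2 \<le> 2 * C * (f x - l)"
proof -
  have "l \<le> f (x + (- (1 / C)) *\<^sub>R g x)" by (rule lower)
  also have "\<dots> \<le> f x + g x \<bullet> ((- (1 / C)) *\<^sub>R g x) + C / 2 * (norm ((- (1 / C)) *\<^sub>R g x))\<^sup>2"
    by (rule descent_lemma[OF g lip])
  also have "\<dots> = f x - (norm (g x))\<^sup>2 / (2 * C)"
    using C by (simp add: power_mult_distrib power_divide dot_square_norm) (simp add: field_simps power2_eq_square)
  finally show ?thesis using C by (simp add: field_simps)
qed

section \<open>One sample path of the method\<close>

text \<open>Summation by parts, done as an induction that retains the boundary term
  \<open>d (Suc n) / t n\<close>. Since \<open>D - d (Suc n)\<close> is nonnegative, passing from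
  \<open>t n\<close> to the smaller \<open>t (Suc n)\<close> only enlarges the bound.\<close>

lemma sum_diff_over_decseq_le:
  fixes d t :: "nat \<Rightarrow> real"
  assumes "K \<ge> 1" and "\<And>k. k < K \<Longrightarrow> d k \<le> D" and "0 \<le> d K"
    and tpos: "\<And>k. k < K \<Longrightarrow> 0 < t k" and tmono: "\<And>k. Suc k < K \<Longrightarrow> t (Suc k) \<le> t k"
  shows "(\<Sum>k<K. (d k - d (Suc k)) / t k) \<le> D / t (K - 1)"
proof -
  have "n < K \<Longrightarrow> (\<Sum>k<Suc n. (d k - d (Suc k)) / t k) + d (Suc n) / t n \<le> D / t n" for n
  proof (induction n)
    case 0
    then show ?case using assms(2)[of 0] tpos[of 0]
      by (simp add: diff_divide_distrib divide_right_mono)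
  next
    case (Suc n)
    have "(D - d (Suc n)) / t n \<le> (D - d (Suc n)) / t (Suc n)"
      using Suc.prems assms(2)[of "Suc n"] tpos[of n] tpos[of "Suc n"] tmono[of n]
      by (intro divide_left_mono) simp_all
    with Suc show ?case by (simp add: diff_divide_distrib)
  qed
  from this[of "K - 1"] assms(1)
  have "(\<Sum>k<K. (d k - d (Suc k)) / t k) + d K / t (K - 1) \<le> D / t (K - 1)" by simp
  moreover have "0 \<le> d K / t (K - 1)"
    using assms(1,3) tpos[of "K - 1"] by simp
  ultimately show ?thesis by linarith
qed

text \<open>The method does not anticipate: state \<open>k\<close> depends only on samples with
  index below \<open>k\<close>. This later makes the iterate independent of the block drawn at
  it.\<close>

lemma sbbp_cong:
  "(\<And>j. j < k \<Longrightarrow> s j = s' j) \<Longrightarrow>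
    sbbp \<psi> \<tau> f \<mu> lstar lam gb x0 xs0 s k = sbbp \<psi> \<tau> f \<mu> lstar lam gb x0 xs0 s' k"
  by (induction k) simp_all

text \<open>The pathwise analysis is deterministic. \<open>S\<close> stands for the blocks that can
  occur and is instantiated by the support of the sampling law.\<close>

locale decmsps_method =
  fixes \<psi> :: "'a::euclidean_space \<Rightarrow> real" and f :: "nat \<Rightarrow> 'a \<Rightarrow> real"
    and L lam :: "nat \<Rightarrow> real" and \<mu> gb :: real and m \<tau> :: nat
    and lstar :: "nat set \<Rightarrow> real" and x0 xs0 :: 'a and S :: "nat set set"
  assumes mu_pos: "\<mu> > 0" and psi: "strongly_convex \<mu> \<psi>"
    and f_convex: "\<And>i. i \<in> {1..m} \<Longrightarrow> convex_on UNIV (f i)"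
    and f_diff: "\<And>i y. i \<in> {1..m} \<Longrightarrow> f i differentiable (at y)"
    and L_pos: "\<And>i. i \<in> {1..m} \<Longrightarrow> L i > 0"
    and f_lip: "\<And>i. i \<in> {1..m} \<Longrightarrow> (L i)-lipschitz_on UNIV (gradient (f i))"
    and tau: "\<tau> \<in> {1..m}"
    and S_blocks: "S \<subseteq> blocks m \<tau>"
    and lstar_le: "\<And>A y. A \<in> S \<Longrightarrow> lstar A \<le> block_fun \<tau> f A y"
    and lam_dec: "decseq lam" and lam_pos: "\<And>k. 0 < lam k"
    and gb_pos: "gb > 0"
    and xs0: "xs0 \<in> subdifferential \<psi> x0"
begin

abbreviation primal :: "(nat \<Rightarrow> nat set) \<Rightarrow> nat \<Rightarrow> 'a" where
  "primal s k \<equiv> sbbp_primal \<psi> \<tau> f \<mu> lstar lam gb x0 xs0 s k"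

abbreviation dual :: "(nat \<Rightarrow> nat set) \<Rightarrow> nat \<Rightarrow> 'a" where
  "dual s k \<equiv> sbbp_dual \<psi> \<tau> f \<mu> lstar lam gb x0 xs0 s k"

text \<open>This is t_k: state \<open>Suc k\<close> stores the step size that produced it.\<close>

definition step :: "(nat \<Rightarrow> nat set) \<Rightarrow> nat \<Rightarrow> real" where
  "step s k = snd (snd (sbbp \<psi> \<tau> f \<mu> lstar lam gb x0 xs0 s (Suc k)))"

(* Index shift: this is t_(k-1) / lam_(k-1), the quotient that enters the rule for t_k. *)
definition ratio :: "(nat \<Rightarrow> nat set) \<Rightarrow> nat \<Rightarrow> real" where
  "ratio s k = snd (snd (sbbp \<psi> \<tau> f \<mu> lstar lam gb x0 xs0 s k)) / lam (k - 1)"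

abbreviation Lmax :: real where "Lmax \<equiv> Max (L ` {1..m})"

lemma primal_0: "primal s 0 = x0" and dual_0: "dual s 0 = xs0" and ratio_0: "ratio s 0 = gb / lam 0"
  by (simp_all add: sbbp_primal_def sbbp_dual_def ratio_def)

lemma ratio_Suc: "ratio s (Suc k) = step s k / lam k"
  by (simp add: ratio_def step_def)

lemma step_eq: "step s k = decmsps \<tau> f \<mu> lstar (lam k) (ratio s k) (s k) (primal s k)"
  by (simp add: step_def ratio_def sbbp_primal_def Let_def split: prod.splits)

lemma dual_Suc: "dual s (Suc k) = dual s k - step s k *\<^sub>R block_grad \<tau> f (s k) (primal s k)"
  by (simp add: step_def sbbp_primal_def sbbp_dual_def Let_def split: prod.splits)

lemma primal_Suc: "primal s (Suc k) = gradient (fenchel_conjugate \<psi>) (dual s (Suc k))"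
  by (simp add: sbbp_primal_def sbbp_dual_def Let_def split: prod.splits)

text \<open>Some point has the new dual iterate as a subgradient, and the gradient of the conjugate
  returns exactly that point. No induction is involved.\<close>

lemma dual_in_subdifferential: "dual s k \<in> subdifferential \<psi> (primal s k)"
proof (cases k)
  case (Suc j)
  obtain x where "dual s (Suc j) \<in> subdifferential \<psi> x"
    using strongly_convex_ex_subgradient_point[OF psi mu_pos xs0] by blast
  then show ?thesis
    using gradient_fenchel_conjugate_eqI[OF psi mu_pos] by (simp add: Suc primal_Suc)
qed (simp add: primal_0 dual_0 xs0)

section \<open>Convexity and smoothness of the block functions\<close>

lemma Lmax_pos: "Lmax > 0"
  using L_pos[OF tau] tau by (subst Max_gr_iff) auto

lemma block_subset: "A \<in> blocks m \<tau> \<Longrightarrow> i \<in> A \<Longrightarrow> i \<in> {1..m}"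
  by (auto simp: blocks_def)

lemma GDERIV_block_fun:
  assumes "A \<in> blocks m \<tau>"
  shows "GDERIV (block_fun \<tau> f A) y :> block_grad \<tau> f A y"
proof -
  have "(f i has_derivative (\<lambda>h. h \<bullet> gradient (f i) y)) (at y)" if "i \<in> A" for i
    using GDERIV_gradient[OF f_diff[OF block_subset[OF assms that]]] by (simp add: gderiv_def)
  then have "((\<lambda>y. \<Sum>i\<in>A. 1 / real \<tau> * f i y) has_derivative
      (\<lambda>h. \<Sum>i\<in>A. 1 / real \<tau> * (h \<bullet> gradient (f i) y))) (at y)"
    by (intro has_derivative_sum has_derivative_mult_right)
  then show ?thesis
    by (simp add: gderiv_def block_fun_def[abs_def] block_grad_def inner_sum_right)
qed

lemma convex_on_block_fun:
  assumes "A \<in> blocks m \<tau>"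
  shows "convex_on UNIV (block_fun \<tau> f A)"
proof (rule convex_onI)
  fix t :: real and a b :: 'a assume t: "0 < t" "t < 1"
  have "1 / real \<tau> * f i ((1 - t) *\<^sub>R a + t *\<^sub>R b)
      \<le> (1 - t) * (1 / real \<tau> * f i a) + t * (1 / real \<tau> * f i b)" if "i \<in> A" for i
    using mult_left_mono[OF convex_onD[OF f_convex[OF block_subset[OF assms that]], of t a b],
        of "1 / real \<tau>"] t by (simp add: add_divide_distrib)
  then show "block_fun \<tau> f A ((1 - t) *\<^sub>R a + t *\<^sub>R b)
      \<le> (1 - t) * block_fun \<tau> f A a + t * block_fun \<tau> f A b"
    unfolding block_fun_def sum_distrib_left sum.distrib[symmetric] by (rule sum_mono)
qed simp

text \<open>A block has \<tau> elements of weight \<open>1 / real \<tau>\<close>, so the individual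
  Lipschitz constants are averaged, and an average is at most \<open>Lmax\<close>.\<close>

lemma block_grad_lipschitz:
  assumes "A \<in> blocks m \<tau>"
  shows "Lmax-lipschitz_on UNIV (block_grad \<tau> f A)"
proof (rule lipschitz_onI)
  fix y z :: 'a
  have "dist (block_grad \<tau> f A y) (block_grad \<tau> f A z)
      = norm (\<Sum>i\<in>A. (1 / real \<tau>) *\<^sub>R (gradient (f i) y - gradient (f i) z))"
    by (simp add: dist_norm block_grad_def sum_subtractf scaleR_diff_right)
  also have "\<dots> \<le> (\<Sum>i\<in>A. Lmax * dist y z / real \<tau>)"
  proof (rule sum_norm_le)
    fix i assume "i \<in> A"
    then have i: "i \<in> {1..m}" by (rule block_subset[OF assms])
    have "norm (gradient (f i) y - gradient (f i) z) \<le> L i * dist y z"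
      using lipschitz_onD[OF f_lip[OF i]] by (simp add: dist_norm)
    also have "\<dots> \<le> Lmax * dist y z"
      using i by (intro mult_right_mono Max_ge) auto
    finally show "norm ((1 / real \<tau>) *\<^sub>R (gradient (f i) y - gradient (f i) z))
        \<le> Lmax * dist y z / real \<tau>"
      by (simp add: divide_right_mono)
  qed
  also have "\<dots> = Lmax * dist y z"
    using assms tau by (simp add: blocks_def)
  finally show "dist (block_grad \<tau> f A y) (block_grad \<tau> f A z) \<le> Lmax * dist y z" .
qed (use Lmax_pos in simp)

lemma block_grad_sq_le:
  assumes "A \<in> S"
  shows "(norm (block_grad \<tau> f A y))\<^sup>2 \<le> 2 * Lmax * (block_fun \<tau> f A y - lstar A)"
  using norm_gradient_sq_le[OF GDERIV_block_fun block_grad_lipschitz Lmax_pos lstar_le[OF assms]]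
    assms S_blocks by blast

section \<open>Bounds on the step size\<close>

lemma decmsps_le: "0 < c \<Longrightarrow> decmsps \<tau> f \<mu> lstar c r A y \<le> c * r"
  by (simp add: decmsps_def)

text \<open>Smoothness bounds the Polyak quotient below by \<open>\<mu> / (2 * Lmax)\<close>. With a
  zero gradient the step is \<open>c * r\<close>, which satisfies the bound as well.\<close>

lemma le_decmsps:
  assumes "A \<in> S" "0 < c"
  shows "c * min (\<mu> / (2 * Lmax)) r \<le> decmsps \<tau> f \<mu> lstar c r A y"
proof (cases "block_grad \<tau> f A y = 0")
  case False
  let ?g = "(norm (block_grad \<tau> f A y))\<^sup>2"
  have "1 / (2 * Lmax) \<le> (block_fun \<tau> f A y - lstar A) / ?g"
    using block_grad_sq_le[OF assms(1), of y] Lmax_pos False by (simp add: field_simps)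
  from mult_left_mono[OF this, of \<mu>]
  have "\<mu> / (2 * Lmax) \<le> \<mu> * ((block_fun \<tau> f A y - lstar A) / ?g)"
    using mu_pos by simp
  then show ?thesis
    using assms(2) False unfolding decmsps_def by (simp add: min.coboundedI1)
qed (use assms in \<open>simp add: decmsps_def\<close>)

text \<open>The step is at most \<open>c\<close> times the Polyak quotient, whose denominator
  cancels here. With a zero gradient the left side vanishes and \<open>lstar_le\<close> makes the
  right side nonnegative.\<close>

lemma decmsps_mult_norm_sq_le:
  assumes "A \<in> S" "0 < c"
  shows "decmsps \<tau> f \<mu> lstar c r A y * (norm (block_grad \<tau> f A y))\<^sup>2
    \<le> c * \<mu> * (block_fun \<tau> f A y - lstar A)"
proof (cases "block_grad \<tau> f A y = 0")
  case True
  then show ?thesis using lstar_le[OF assms(1), of y] assms(2) mu_pos by simp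
next
  case False
  let ?g = "(norm (block_grad \<tau> f A y))\<^sup>2"
  have "decmsps \<tau> f \<mu> lstar c r A y \<le> c * (\<mu> * ((block_fun \<tau> f A y - lstar A) / ?g))"
    using False assms(2) by (simp only: decmsps_def norm_eq_zero if_False mult_le_cancel_left_pos min.cobounded1)
  from mult_right_mono[OF this, of ?g] show ?thesis using False by simp
qed

text \<open>Each step replaces the ratio by something at least its minimum with
  \<open>\<mu> / (2 * Lmax)\<close>, so only that constant and the initial ratio
  \<open>gb / lam 0\<close> can limit it.\<close>

lemma ratio_ge:
  assumes "\<And>j. j < k \<Longrightarrow> s j \<in> S"
  shows "min (\<mu> / (2 * Lmax)) (gb / lam 0) \<le> ratio s k"
  using assms
proof (induction k)
  case (Suc k)
  have "min (\<mu> / (2 * Lmax)) (gb / lam 0) \<le> min (\<mu> / (2 * Lmax)) (ratio s k)"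
    using Suc by simp
  also have "\<dots> \<le> step s k / lam k"
    using le_decmsps[of "s k" "lam k"] Suc.prems lam_pos[of k]
    by (simp add: step_eq field_simps)
  finally show ?case by (simp add: ratio_Suc)
qed (simp add: ratio_0)

lemma min_pos: "0 < min (\<mu> / (2 * Lmax)) (gb / lam 0)"
  using mu_pos Lmax_pos gb_pos lam_pos[of 0] by simp

lemma step_ge:
  assumes "\<And>j. j \<le> k \<Longrightarrow> s j \<in> S"
  shows "lam k * min (\<mu> / (2 * Lmax)) (gb / lam 0) \<le> step s k"
  using ratio_ge[of "Suc k" s] assms lam_pos[of k] by (simp add: ratio_Suc le_divide_eq mult.commute)

lemma step_pos: "(\<And>j. j \<le> k \<Longrightarrow> s j \<in> S) \<Longrightarrow> 0 < step s k"
  using step_ge[of k s] min_pos lam_pos[of k] by (smt (verit) mult_pos_pos)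

text \<open>Both the ratio of step size to relaxation parameter and the parameter itself are
  nonincreasing, hence so is their product.\<close>

lemma step_Suc_le:
  assumes "\<And>j. j \<le> Suc k \<Longrightarrow> s j \<in> S"
  shows "step s (Suc k) \<le> step s k"
proof -
  have "step s (Suc k) \<le> lam (Suc k) * (step s k / lam k)"
    unfolding step_eq[of s "Suc k"] ratio_Suc by (rule decmsps_le[OF lam_pos])
  also have "\<dots> \<le> lam k * (step s k / lam k)"
    using step_pos[of k s] assms lam_pos[of k] decseqD[OF lam_dec, of k "Suc k"]
    by (intro mult_right_mono) (auto intro: less_imp_le)
  finally show ?thesis using lam_pos[of k] by simp
qed

text \<open>Convexity turns the linear term of the mirror step into the block gap; the Polyak bound
  turns the quadratic one into \<open>lam k / 2\<close> times the excess over \<open>lstar\<close>.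
  Dividing by the random step size leaves deterministic coefficients on the left, so that
  expectations can be taken term by term.\<close>

lemma one_step:
  assumes "\<And>j. j \<le> k \<Longrightarrow> s j \<in> S"
  shows "block_fun \<tau> f (s k) (primal s k) - block_fun \<tau> f (s k) z
      - lam k / 2 * (block_fun \<tau> f (s k) (primal s k) - lstar (s k))
    \<le> (bregman \<psi> (dual s k) (primal s k) z - bregman \<psi> (dual s (Suc k)) (primal s (Suc k)) z)
      / step s k"
proof -
  let ?t = "step s k" and ?g = "block_grad \<tau> f (s k) (primal s k)"
    and ?a = "block_fun \<tau> f (s k) (primal s k)" and ?b = "block_fun \<tau> f (s k) z"
  have sk: "s k \<in> S" using assms by simp
  then have blk: "s k \<in> blocks m \<tau>" using S_blocks by blast
  have t: "?t > 0" using step_pos assms .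
  have "bregman \<psi> (dual s (Suc k)) (primal s (Suc k)) z
      \<le> bregman \<psi> (dual s k) (primal s k) z + (?t *\<^sub>R ?g) \<bullet> (z - primal s k)
        + (norm (?t *\<^sub>R ?g))\<^sup>2 / (2 * \<mu>)"
    unfolding dual_Suc by (rule bregman_mirror_step[OF psi mu_pos dual_in_subdifferential])
  moreover have "(?t *\<^sub>R ?g) \<bullet> (z - primal s k) \<le> ?t * (?b - ?a)"
    using convex_on_gradient_le[OF convex_on_block_fun GDERIV_block_fun, OF blk blk,
        of "primal s k" z] t by simp
  moreover have "(norm (?t *\<^sub>R ?g))\<^sup>2 / (2 * \<mu>) \<le> ?t * (lam k / 2 * (?a - lstar (s k)))"
  proof -
    have "?t * (norm ?g)\<^sup>2 \<le> lam k * \<mu> * (?a - lstar (s k))"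
      unfolding step_eq by (rule decmsps_mult_norm_sq_le[OF sk lam_pos])
    from mult_left_mono[OF this, of ?t] show ?thesis
      using t mu_pos by (simp add: field_simps power2_eq_square)
  qed
  ultimately have "?t * (?a - ?b - lam k / 2 * (?a - lstar (s k)))
      \<le> bregman \<psi> (dual s k) (primal s k) z - bregman \<psi> (dual s (Suc k)) (primal s (Suc k)) z"
    by (simp add: right_diff_distrib)
  then show ?thesis using t by (simp add: pos_le_divide_eq mult.commute)
qed

lemma path_bound:
  assumes s: "\<And>j. s j \<in> S" and K: "K \<ge> 1"
    and D: "\<And>k. k < K \<Longrightarrow> bregman \<psi> (dual s k) (primal s k) z \<le> D"
  shows "(\<Sum>k<K. block_fun \<tau> f (s k) (primal s k) - block_fun \<tau> f (s k) z
      - lam k / 2 * (block_fun \<tau> f (s k) (primal s k) - lstar (s k)))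
    \<le> D / (lam (K - 1) * min (\<mu> / (2 * Lmax)) (gb / lam 0))"
proof -
  let ?d = "\<lambda>k. bregman \<psi> (dual s k) (primal s k) z"
  have d: "0 \<le> ?d k" for k by (rule bregman_nonneg[OF dual_in_subdifferential])
  have "(\<Sum>k<K. block_fun \<tau> f (s k) (primal s k) - block_fun \<tau> f (s k) z
      - lam k / 2 * (block_fun \<tau> f (s k) (primal s k) - lstar (s k)))
    \<le> (\<Sum>k<K. (?d k - ?d (Suc k)) / step s k)"
    by (rule sum_mono) (rule one_step[OF s])
  also have "\<dots> \<le> D / step s (K - 1)"
    by (rule sum_diff_over_decseq_le) (use K D d step_pos step_Suc_le s in auto)
  \<comment> \<open>Replacing the last step by its lower bound needs \<open>D\<close> nonnegative,
    which follows from the distance at index 0.\<close>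
  also have "\<dots> \<le> D / (lam (K - 1) * min (\<mu> / (2 * Lmax)) (gb / lam 0))"
  proof (rule divide_left_mono)
    show "0 \<le> D" using d[of 0] D[of 0] K by simp
  qed (use step_ge s step_pos min_pos lam_pos in auto)
  finally show ?thesis .
qed

end

section \<open>Expectations under block sampling\<close>

lemma finite_blocks: "finite (blocks m \<tau>)"
  by (rule finite_subset[of _ "Pow {1..m}"]) (auto simp: blocks_def)

text \<open>Independence is stated with values in \<open>blocks m \<tau>\<close>, the law with
  values in all sets, so both codomains occur.\<close>

lemma block_sampling_measurable:
  assumes "block_sampling M J p m \<tau>"
  shows "J k \<in> measurable M (count_space (blocks m \<tau>))"
    and "J k \<in> measurable M (count_space UNIV)"
proof -
  interpret prob_space M using assms by (simp add: block_sampling_def)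
  show 1: "J k \<in> measurable M (count_space (blocks m \<tau>))"
    using assms by (simp add: block_sampling_def indep_vars_def)
  have "(\<lambda>A. A) \<in> measurable (count_space (blocks m \<tau>)) (count_space UNIV)" by simp
  from measurable_compose[OF 1 this] show "J k \<in> measurable M (count_space UNIV)" .
qed

text \<open>The law fixes the support only up to null sets; countably many indices still give one
  exceptional null set.\<close>

lemma block_sampling_AE:
  assumes "block_sampling M J p m \<tau>"
  shows "AE \<omega> in M. \<forall>k. J k \<omega> \<in> set_pmf p"
proof -
  have "AE \<omega> in M. J k \<omega> \<in> set_pmf p" for k
  proof -
    have eq: "distr M (count_space UNIV) (J k) = measure_pmf p"
      using assms by (simp add: block_sampling_def)
    have "AE A in distr M (count_space UNIV) (J k). A \<in> set_pmf p"
      unfolding eq by (rule AE_measure_pmf)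
    then show ?thesis
      by (subst (asm) AE_distr_iff[OF block_sampling_measurable(2)[OF assms]]) simp_all
  qed
  then show ?thesis by (simp add: AE_all_countable)
qed

lemma block_sampling_expectation:
  fixes g :: "nat set \<Rightarrow> real"
  assumes "block_sampling M J p m \<tau>"
  shows "prob_space.expectation M (\<lambda>\<omega>. g (J k \<omega>)) = measure_pmf.expectation p g"
proof -
  have "measure_pmf.expectation p g = integral\<^sup>L (distr M (count_space UNIV) (J k)) g"
    using assms by (simp add: block_sampling_def)
  also have "\<dots> = integral\<^sup>L M (\<lambda>\<omega>. g (J k \<omega>))"
    by (rule integral_distr[OF block_sampling_measurable(2)[OF assms]]) simp
  finally show ?thesis ..
qed

lemma PiM_blocks:
  assumes "finite I"
  shows "PiM I (\<lambda>_. count_space (blocks m \<tau>)) = count_space (I \<rightarrow>\<^sub>E blocks m \<tau>)"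
  by (rule count_space_PiM_finite[OF assms countable_finite[OF finite_blocks]])

text \<open>Finitely many samples from a finite set of blocks have finitely many outcomes, so any
  real function of them is measurable and bounded.\<close>

lemma block_sampling_integrable:
  fixes h :: "(nat \<Rightarrow> nat set) \<Rightarrow> real"
  assumes "block_sampling M J p m \<tau>" "finite I"
  shows "integrable M (\<lambda>\<omega>. h (restrict (\<lambda>j. J j \<omega>) I))"
proof -
  interpret prob_space M using assms by (simp add: block_sampling_def)
  let ?P = "I \<rightarrow>\<^sub>E blocks m \<tau>"
  have meas: "(\<lambda>\<omega>. restrict (\<lambda>j. J j \<omega>) I) \<in> measurable M (count_space ?P)"
    unfolding PiM_blocks[OF assms(2), symmetric]
    by (intro measurable_restrict block_sampling_measurable(1)[OF assms(1)])
  have fin: "finite ?P" by (intro finite_PiE assms(2) finite_blocks)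
  show ?thesis
  proof (rule integrable_const_bound)
    show "AE \<omega> in M. norm (h (restrict (\<lambda>j. J j \<omega>) I)) \<le> Max ((\<lambda>s. \<bar>h s\<bar>) ` ?P)"
    proof (rule AE_I2)
      fix \<omega> assume "\<omega> \<in> space M"
      then have "restrict (\<lambda>j. J j \<omega>) I \<in> ?P"
        using measurable_space[OF meas] by simp
      then show "norm (h (restrict (\<lambda>j. J j \<omega>) I)) \<le> Max ((\<lambda>s. \<bar>h s\<bar>) ` ?P)"
        using fin by (simp add: Max_ge)
    qed
    show "(\<lambda>\<omega>. h (restrict (\<lambda>j. J j \<omega>) I)) \<in> borel_measurable M"
      by (rule measurable_compose[OF meas]) simp
  qed
qed

text \<open>The index sets \<open>{k}\<close> and \<open>{..<k}\<close> are disjoint, so the current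
  block is independent of the whole history.\<close>

lemma block_sampling_expectation_mult:
  fixes g :: "nat set \<Rightarrow> real" and h :: "(nat \<Rightarrow> nat set) \<Rightarrow> real"
  assumes bs: "block_sampling M J p m \<tau>"
  shows "prob_space.expectation M (\<lambda>\<omega>. g (J k \<omega>) * h (restrict (\<lambda>j. J j \<omega>) {..<k}))
    = measure_pmf.expectation p g * prob_space.expectation M (\<lambda>\<omega>. h (restrict (\<lambda>j. J j \<omega>) {..<k}))"
proof -
  interpret prob_space M using bs by (simp add: block_sampling_def)
  have "indep_vars (\<lambda>_. count_space (blocks m \<tau>)) J UNIV"
    using bs by (simp add: block_sampling_def)
  from indep_var_restrict[OF this, of "{k}" "{..<k}"]
  have "indep_var (count_space ({k} \<rightarrow>\<^sub>E blocks m \<tau>)) (\<lambda>\<omega>. restrict (\<lambda>j. J j \<omega>) {k})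
      (count_space ({..<k} \<rightarrow>\<^sub>E blocks m \<tau>)) (\<lambda>\<omega>. restrict (\<lambda>j. J j \<omega>) {..<k})"
    by (simp add: PiM_blocks)
  then have "indep_var borel ((\<lambda>s. g (s k)) \<circ> (\<lambda>\<omega>. restrict (\<lambda>j. J j \<omega>) {k}))
      borel (h \<circ> (\<lambda>\<omega>. restrict (\<lambda>j. J j \<omega>) {..<k}))"
    by (rule indep_var_compose) simp_all
  then have "indep_var borel (\<lambda>\<omega>. g (J k \<omega>)) borel (\<lambda>\<omega>. h (restrict (\<lambda>j. J j \<omega>) {..<k}))"
    by (simp add: comp_def)
  moreover have "integrable M (\<lambda>\<omega>. g (J k \<omega>))"
    using block_sampling_integrable[OF bs, of "{k}" "\<lambda>s. g (s k)"] by simp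
  moreover have "integrable M (\<lambda>\<omega>. h (restrict (\<lambda>j. J j \<omega>) {..<k}))"
    by (rule block_sampling_integrable[OF bs]) simp
  ultimately have "expectation (\<lambda>\<omega>. g (J k \<omega>) * h (restrict (\<lambda>j. J j \<omega>) {..<k}))
      = expectation (\<lambda>\<omega>. g (J k \<omega>)) * expectation (\<lambda>\<omega>. h (restrict (\<lambda>j. J j \<omega>) {..<k}))"
    by (rule indep_var_lebesgue_integral)
  then show ?thesis by (simp only: block_sampling_expectation[OF bs])
qed

text \<open>Unbiasedness at a point chosen from the history: write the block value with membership
  indicators divided by \<tau>. Each has mean \<open>1 / real m\<close> and is independent of the
  history.\<close>

lemma block_sampling_expectation_block_fun:
  fixes Z :: "(nat \<Rightarrow> nat set) \<Rightarrow> 'a"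
  assumes bs: "block_sampling M J p m \<tau>" and \<tau>: "\<tau> \<ge> 1"
  shows "prob_space.expectation M (\<lambda>\<omega>. block_fun \<tau> f (J k \<omega>) (Z (restrict (\<lambda>j. J j \<omega>) {..<k})))
    = prob_space.expectation M (\<lambda>\<omega>. objective m f (Z (restrict (\<lambda>j. J j \<omega>) {..<k})))"
    (is "?E1 = ?E2")
proof -
  interpret prob_space M using bs by (simp add: block_sampling_def)
  let ?R = "\<lambda>\<omega>. restrict (\<lambda>j. J j \<omega>) {..<k}"
  have int: "integrable M (\<lambda>\<omega>. f i (Z (?R \<omega>)))" for i
    by (rule block_sampling_integrable[OF bs, of "{..<k}" "\<lambda>s. f i (Z s)"]) simp
  have int': "integrable M (\<lambda>\<omega>. indicator {A. i \<in> A} (J k \<omega>) / \<tau> * f i (Z (?R \<omega>)))" for i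
  proof -
    \<comment> \<open>The integrand involves sample \<open>k\<close> as well as the history, so the
      window is \<open>{..k}\<close> and the history is a restriction of it.\<close>
    have "restrict (restrict (\<lambda>j. J j \<omega>) {..k}) {..<k} = ?R \<omega>" for \<omega>
      by (simp add: restrict_def fun_eq_iff)
    with block_sampling_integrable[OF bs, of "{..k}"
        "\<lambda>s. indicator {A. i \<in> A} (s k) / \<tau> * f i (Z (restrict s {..<k}))"]
    show ?thesis by simp
  qed
  have eq: "block_fun \<tau> f A y = (\<Sum>i=1..m. indicator {A. i \<in> A} A / \<tau> * f i y)"
    if "A \<in> blocks m \<tau>" for A y
  proof -
    have "block_fun \<tau> f A y = (\<Sum>i\<in>{1..m} \<inter> A. f i y / \<tau>)"
      using that by (simp add: block_fun_def blocks_def Int_absorb1)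
    also have "\<dots> = (\<Sum>i=1..m. if i \<in> A then f i y / \<tau> else 0)"
      by (rule sum.inter_restrict) simp
    also have "\<dots> = (\<Sum>i=1..m. indicator {A. i \<in> A} A / \<tau> * f i y)"
      by (rule sum.cong) (auto simp: indicator_def)
    finally show ?thesis .
  qed
  have "?E1 = expectation (\<lambda>\<omega>. \<Sum>i=1..m. indicator {A. i \<in> A} (J k \<omega>) / \<tau> * f i (Z (?R \<omega>)))"
    using measurable_space[OF block_sampling_measurable(1)[OF bs]]
    by (intro Bochner_Integration.integral_cong refl eq) simp
  also have "\<dots> = (\<Sum>i=1..m. expectation (\<lambda>\<omega>. indicator {A. i \<in> A} (J k \<omega>) / \<tau> * f i (Z (?R \<omega>))))"
    by (rule Bochner_Integration.integral_sum[OF int'])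
  also have "\<dots> = (\<Sum>i=1..m. measure_pmf.expectation p (\<lambda>A. indicator {A. i \<in> A} A / \<tau>)
      * expectation (\<lambda>\<omega>. f i (Z (?R \<omega>))))"
    by (intro sum.cong refl block_sampling_expectation_mult[OF bs])
  also have "\<dots> = (\<Sum>i=1..m. 1 / real m * expectation (\<lambda>\<omega>. f i (Z (?R \<omega>))))"
  proof (intro sum.cong refl arg_cong2[where f = "(*)"])
    fix i assume "i \<in> {1..m}"
    then have "measure_pmf.prob p {A. i \<in> A} = \<tau> / m"
      using bs by (simp add: block_sampling_def)
    moreover have "(\<lambda>A. indicator {A. i \<in> A} A) = (indicator {A. i \<in> A} :: nat set \<Rightarrow> real)"
      by (simp add: indicator_def fun_eq_iff)
    ultimately show "measure_pmf.expectation p (\<lambda>A. indicator {A. i \<in> A} A / \<tau>) = 1 / real m"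
      using \<tau> by simp
  qed
  also have "\<dots> = ?E2"
    using int by (simp add: objective_def sum_distrib_left sum_divide_distrib)
  finally show ?thesis .
qed

text \<open>Jensen's inequality with equal weights, applied to each \<open>f i\<close> and
  summed.\<close>

lemma objective_average_le:
  assumes "\<And>i. i \<in> {1..m} \<Longrightarrow> convex_on UNIV (f i)" and "K \<ge> 1"
  shows "objective m f ((1 / real K) *\<^sub>R (\<Sum>k=0..K - 1. y k))
    \<le> 1 / real K * (\<Sum>k=0..K - 1. objective m f (y k))"
proof -
  let ?y = "(1 / real K) *\<^sub>R (\<Sum>k=0..K - 1. y k)"
  have "f i ?y \<le> (\<Sum>k=0..K - 1. 1 / real K * f i (y k))" if "i \<in> {1..m}" for i
  proof -
    have "(\<Sum>k=0..K - 1. 1 / real K) = 1" using assms(2) by simp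
    from convex_on_sum[OF _ _ assms(1)[OF that] this, of y]
    show ?thesis by (simp add: scaleR_sum_right)
  qed
  then have "(\<Sum>i=1..m. f i ?y) \<le> (\<Sum>i=1..m. \<Sum>k=0..K - 1. 1 / real K * f i (y k))"
    by (rule sum_mono)
  also have "\<dots> = 1 / real K * (\<Sum>k=0..K - 1. \<Sum>i=1..m. f i (y k))"
    by (subst sum.swap) (simp only: sum_distrib_left)
  finally have "1 / real m * (\<Sum>i=1..m. f i ?y)
      \<le> 1 / real m * (1 / real K * (\<Sum>k=0..K - 1. \<Sum>i=1..m. f i (y k)))"
    by (rule mult_left_mono) simp
  also have "\<dots> = 1 / real K * (\<Sum>k=0..K - 1. 1 / real m * (\<Sum>i=1..m. f i (y k)))"
    by (simp only: sum_distrib_left mult.left_commute)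
  finally show ?thesis by (simp only: objective_def)
qed

section \<open>Assembly of the bound in expectation\<close>

theorem theorem2:
  fixes \<psi> :: "real ^ 'n \<Rightarrow> real"
    and f :: "nat \<Rightarrow> real ^ 'n \<Rightarrow> real"
    and L lam :: "nat \<Rightarrow> real"
    and \<mu> gb D :: real
    and m \<tau> K :: nat
    and lstar :: "nat set \<Rightarrow> real"
    and x0 xs0 xh :: "real ^ 'n"
    and M :: "'w measure"
    and J :: "nat \<Rightarrow> 'w \<Rightarrow> nat set"
    and p :: "nat set pmf"
  defines "x \<equiv> sbbp_primal \<psi> \<tau> f \<mu> lstar lam gb x0 xs0"
    and "xs \<equiv> sbbp_dual \<psi> \<tau> f \<mu> lstar lam gb x0 xs0"
    and "F \<equiv> objective m f"
    and "Ltilde \<equiv> min (\<mu> / (2 * Max (L ` {1..m}))) (gb / lam 0)"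
  assumes "\<mu> > 0" and "strongly_convex \<mu> \<psi>"
    and "m \<ge> 1"
    and "\<And>i. i \<in> {1..m} \<Longrightarrow> convex_on UNIV (f i)"
    and "\<And>i y. i \<in> {1..m} \<Longrightarrow> f i differentiable (at y)"
    and "\<And>i. i \<in> {1..m} \<Longrightarrow> L i > 0"
    and "\<And>i. i \<in> {1..m} \<Longrightarrow> (L i)-lipschitz_on UNIV (gradient (f i))"
    and "\<tau> \<in> {1..m}"
    and "block_sampling M J p m \<tau>"
    and "\<And>A. A \<in> set_pmf p \<Longrightarrow> ereal (lstar A) \<le> (INF y. ereal (block_fun \<tau> f A y))"
    and "decseq lam"
    and "\<And>k. 0 < lam k" and "\<And>k. lam k \<le> 1"
    and "gb > 0"
    and "xs0 \<in> subdifferential \<psi> x0"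
    and "xh \<in> argmin_set F"
    and "K \<ge> 1"
    and "D = Max ((\<lambda>(k, s). bregman \<psi> (xs s k) (x s k) xh) `
                    ({..K - 1} \<times> ({..<K} \<rightarrow>\<^sub>E set_pmf p)))"
  shows "prob_space.expectation M
           (\<lambda>\<omega>. F ((1 / real K) *\<^sub>R (\<Sum>k=0..K - 1. x (\<lambda>j. J j \<omega>) k)) - (INF y. F y))
         \<le> 1 / real K * (2 * D / (lam (K - 1) * Ltilde)
              + noise_const \<tau> f lstar p xh * (\<Sum>k=0..K - 1. lam k))"
proof -
  note bs = \<open>block_sampling M J p m \<tau>\<close>
  interpret prob_space M using bs by (simp add: block_sampling_def)
  have p: "set_pmf p \<subseteq> blocks m \<tau>" using bs by (simp add: block_sampling_def)
  have lstar_le: "lstar A \<le> block_fun \<tau> f A y" if "A \<in> set_pmf p" for A y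
  proof -
    have "ereal (lstar A) \<le> ereal (block_fun \<tau> f A y)"
      using assms(14)[OF that] by (rule order_trans) (rule INF_lower, simp)
    then show ?thesis by simp
  qed
  interpret decmsps_method \<psi> f L lam \<mu> gb m \<tau> lstar x0 xs0 "set_pmf p"
    by unfold_locales (fact assms p lstar_le)+
  let ?s = "\<lambda>\<omega> j. J j \<omega>" and ?R = "\<lambda>n \<omega>. restrict (\<lambda>j. J j \<omega>) {..<n}"
  have x_cong: "x s k = x s' k" and xs_cong: "xs s k = xs s' k"
    if "\<And>j. j < k \<Longrightarrow> s j = s' j" for s s' k
  proof -
    have "sbbp \<psi> \<tau> f \<mu> lstar lam gb x0 xs0 s k = sbbp \<psi> \<tau> f \<mu> lstar lam gb x0 xs0 s' k"
      by (rule sbbp_cong) (rule that)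
    then show "x s k = x s' k" "xs s k = xs s' k"
      by (simp_all add: x_def xs_def sbbp_primal_def sbbp_dual_def)
  qed
  \<comment> \<open>Exhibits the iterate as a function of finitely many samples:
    \<open>n = k\<close> serves independence, \<open>n = Suc k\<close> adds the current block, and
    \<open>n = K\<close> covers the average.\<close>
  have x_restrict: "x (?s \<omega>) k = x (?R n \<omega>) k" if "k \<le> n" for k n \<omega>
    by (rule x_cong) (use that in simp)
  have xh: "F xh \<le> F y" for y
    using \<open>xh \<in> argmin_set F\<close> by (simp add: argmin_set_def is_arg_min_linorder)
  then have INF: "(INF y. F y) = F xh"
    by (intro cInf_eq_minimum) auto
  \<comment> \<open>The maximum ranges over paths restricted to \<open>{..<K}\<close>; distances at
    indices below \<open>K\<close> do not change under this restriction.\<close>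
  have D: "bregman \<psi> (xs s k) (x s k) xh \<le> D" if s: "\<And>j. s j \<in> set_pmf p" and k: "k < K" for s k
  proof -
    let ?r = "restrict s {..<K}"
    have "bregman \<psi> (xs s k) (x s k) xh = bregman \<psi> (xs ?r k) (x ?r k) xh"
      using x_cong[of k s ?r] xs_cong[of k s ?r] k by simp
    also have "\<dots> \<le> D"
      unfolding \<open>D = _\<close>
    proof (rule Max_ge)
      show "finite ((\<lambda>(k, s). bregman \<psi> (xs s k) (x s k) xh) `
          ({..K - 1} \<times> ({..<K} \<rightarrow>\<^sub>E set_pmf p)))"
        using finite_subset[OF p finite_blocks]
        by (intro finite_imageI finite_cartesian_product finite_PiE) auto
      show "bregman \<psi> (xs ?r k) (x ?r k) xh \<in> (\<lambda>(k, s). bregman \<psi> (xs s k) (x s k) xh) `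
          ({..K - 1} \<times> ({..<K} \<rightarrow>\<^sub>E set_pmf p))"
        by (rule image_eqI[of _ _ "(k, ?r)"]) (use s k in auto)
    qed
    finally show ?thesis .
  qed
  \<comment> \<open>The excess \<open>a k \<omega> - lstar (J k \<omega>)\<close> splits into the
    gap \<open>a k \<omega> - b k \<omega>\<close> plus the noise \<open>n k \<omega>\<close>, which
    produces the factor \<open>1 - lam k / 2\<close> on the gap.\<close>
  define a where "a k \<omega> = block_fun \<tau> f (J k \<omega>) (x (?s \<omega>) k)" for k \<omega>
  define b where "b k \<omega> = block_fun \<tau> f (J k \<omega>) xh" for k \<omega>
  define n where "n k \<omega> = b k \<omega> - lstar (J k \<omega>)" for k \<omega>
  define \<sigma> where "\<sigma> = noise_const \<tau> f lstar p xh"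
  define e where "e k = expectation (\<lambda>\<omega>. F (x (?s \<omega>) k)) - F xh" for k
  have int_a [simp]: "integrable M (a k)" for k
    using block_sampling_integrable[OF bs, of "{..<Suc k}" "\<lambda>s. block_fun \<tau> f (s k) (x s k)"]
    by (simp add: a_def[abs_def] x_restrict[of k "Suc k", symmetric])
  have int_b [simp]: "integrable M (b k)" for k
    using block_sampling_integrable[OF bs, of "{k}" "\<lambda>s. block_fun \<tau> f (s k) xh"]
    by (simp add: b_def[abs_def])
  have int_n [simp]: "integrable M (n k)" for k
    using block_sampling_integrable[OF bs, of "{k}" "\<lambda>s. block_fun \<tau> f (s k) xh - lstar (s k)"]
    by (simp add: n_def[abs_def] b_def)
  have int_F [simp]: "integrable M (\<lambda>\<omega>. F (x (?s \<omega>) k))" for k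
    using block_sampling_integrable[OF bs, of "{..<k}" "\<lambda>s. F (x s k)"]
    by (simp add: x_restrict[of k k, symmetric])
  have \<tau>1: "\<tau> \<ge> 1" using \<open>\<tau> \<in> {1..m}\<close> by simp
  have E_a: "expectation (a k) = e k + F xh" for k
    using block_sampling_expectation_block_fun[OF bs \<tau>1, of f k "\<lambda>s. x s k"]
    by (simp add: a_def[abs_def] e_def x_restrict[of k k, symmetric] F_def)
  have E_b: "expectation (b k) = F xh" for k
    using block_sampling_expectation_block_fun[OF bs \<tau>1, of f k "\<lambda>s. xh"]
    by (simp add: b_def[abs_def] F_def prob_space)
  have E_n: "expectation (n k) = \<sigma>" for k
    using block_sampling_expectation[OF bs, of "\<lambda>A. block_fun \<tau> f A xh - lstar A" k]
    by (simp add: n_def[abs_def] b_def \<sigma>_def noise_const_def)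
  have e_nonneg: "0 \<le> e k" for k
  proof -
    have "expectation (\<lambda>\<omega>. F xh) \<le> expectation (\<lambda>\<omega>. F (x (?s \<omega>) k))"
      by (rule integral_mono) (simp_all add: xh)
    then show ?thesis by (simp add: e_def prob_space)
  qed
  let ?C = "D / (lam (K - 1) * Ltilde)"
  have "AE \<omega> in M. (\<Sum>k<K. (1 - lam k / 2) * (a k \<omega> - b k \<omega>) - lam k / 2 * n k \<omega>) \<le> ?C"
    using block_sampling_AE[OF bs]
  proof eventually_elim
    case (elim \<omega>)
    have "(\<Sum>k<K. a k \<omega> - b k \<omega> - lam k / 2 * (a k \<omega> - lstar (J k \<omega>))) \<le> ?C"
      unfolding a_def b_def Ltilde_def x_def
      by (rule path_bound) (use elim \<open>K \<ge> 1\<close> D[of "?s \<omega>"] in \<open>auto simp: x_def xs_def\<close>)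
    then show ?case by (simp add: n_def algebra_simps)
  qed
  then have "expectation (\<lambda>\<omega>. \<Sum>k<K. (1 - lam k / 2) * (a k \<omega> - b k \<omega>) - lam k / 2 * n k \<omega>)
      \<le> expectation (\<lambda>\<omega>. ?C)"
    by (intro integral_mono_AE) simp_all
  then have "(\<Sum>k<K. (1 - lam k / 2) * e k - lam k / 2 * \<sigma>) \<le> ?C"
    by (simp add: E_a E_b E_n prob_space)
  \<comment> \<open>Here \<open>lam k \<le> 1\<close> meets the sign of the expected gap. The
    resulting factor one half is the source of the 2 before \<open>D\<close>, and it cancels the one
    half on the noise.\<close>
  moreover have "(\<Sum>k<K. e k / 2 - lam k / 2 * \<sigma>) \<le> (\<Sum>k<K. (1 - lam k / 2) * e k - lam k / 2 * \<sigma>)"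
  proof (rule sum_mono)
    fix k
    have "1 / 2 * e k \<le> (1 - lam k / 2) * e k"
      using \<open>\<And>k. lam k \<le> 1\<close>[of k] e_nonneg by (intro mult_right_mono) simp_all
    then show "e k / 2 - lam k / 2 * \<sigma> \<le> (1 - lam k / 2) * e k - lam k / 2 * \<sigma>" by simp
  qed
  ultimately have "(\<Sum>k<K. e k / 2 - lam k / 2 * \<sigma>) \<le> ?C" by linarith
  moreover have "(\<Sum>k<K. e k / 2 - lam k / 2 * \<sigma>) = ((\<Sum>k<K. e k) - \<sigma> * (\<Sum>k<K. lam k)) / 2"
    by (simp add: sum_subtractf sum_distrib_left sum_divide_distrib diff_divide_distrib mult.commute)
  ultimately have sum_e: "(\<Sum>k<K. e k) \<le> 2 * D / (lam (K - 1) * Ltilde) + \<sigma> * (\<Sum>k<K. lam k)"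
    by simp
  \<comment> \<open>With natural subtraction this relies on \<open>K \<ge> 1\<close>: for
    \<open>K = 0\<close> the left set would be \<open>{0}\<close>.\<close>
  have K_set: "{0..K - 1} = {..<K}" using \<open>K \<ge> 1\<close> by auto
  let ?xbar = "\<lambda>\<omega>. (1 / real K) *\<^sub>R (\<Sum>k=0..K - 1. x (?s \<omega>) k)"
  have "integrable M (\<lambda>\<omega>. F (?xbar \<omega>))"
    using block_sampling_integrable[OF bs, of "{..<K}"
        "\<lambda>s. F ((1 / real K) *\<^sub>R (\<Sum>k<K. x s k))"]
    unfolding K_set by (simp add: x_restrict[of _ K, symmetric])
  then have "expectation (\<lambda>\<omega>. F (?xbar \<omega>) - F xh)
      \<le> expectation (\<lambda>\<omega>. 1 / real K * (\<Sum>k=0..K - 1. F (x (?s \<omega>) k)) - F xh)"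
    unfolding F_def
    by (intro integral_mono diff_right_mono objective_average_le)
      (use assms(8) \<open>K \<ge> 1\<close> int_F in \<open>auto simp: F_def\<close>)
  also have "\<dots> = 1 / real K * (\<Sum>k<K. e k)"
    unfolding K_set using \<open>K \<ge> 1\<close> by (simp add: e_def prob_space sum_subtractf diff_divide_distrib)
  also have "\<dots> \<le> 1 / real K * (2 * D / (lam (K - 1) * Ltilde) + \<sigma> * (\<Sum>k<K. lam k))"
    using sum_e by (intro mult_left_mono) simp_all
  finally show ?thesis by (simp only: INF K_set \<sigma>_def)
qed

end
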